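(* For every $\alpha\in\hat{\mathbb{R}}$ with $\alpha\ge 3^+$ and every integer $k\ge 1$, there is an $\alpha$-free complementary morphism of length $k$.
   Context: Words are finite or (one-sided) infinite and are indexed from position $0$; they are over the alphabet $\{0,1\}$. A factor is a contiguous sub-block. The complement $\overline{w}$ of a binary word $w$ is obtained by exchanging $0$ and $1$ letterwise. For a finite nonempty word $w$ of length $n$, an integer $p$ with $1\le p\le n$ is a period of $w$ if $w[i]=w[i+p]$ for $0\le i<n-p$; $\mathrm{per}(w)$ is the smallest period, and $\exp(w)=n/\mathrm{per}(w)$. The critical exponent $\mathrm{cexp}(w)$ of a finite or infinite word $w$ is the supremum of $\exp(x)$ over all finite nonempty factors $x$ of $w$. $\hat{\mathbb{R}}$ is the ordered set obtained from $\mathbb{R}$ by adding, for every real $\alpha$, an element $\alpha^+$ satisfying $\alpha<\alpha^+<\beta$ for all real $\beta>\alpha$. For real $\alpha>1$, a word $w$ is $\alpha$-free if $\mathrm{cexp}(w)<\alpha$, and $\alpha^+$-free if $\mathrm{cexp}(w)\le\alpha$. A morphism $h$ (a map with $h(xy)=h(x)h(y)$) is $\alpha$-free (for $\alpha\in\hat{\mathbb{R}}$, $\alpha>1$) if for all words $w$: $w$ $\alpha$-free implies $h(w)$ $\alpha$-free. A morphism is $k$-uniform, or of length $k$, if it maps every letter to a word of length $k$. A uniform binary morphism $h:\{0,1\}^*\to\{0,1\}^*$ is complementary if $h(1)=\overline{h(0)}$. *)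

theory Defs
  imports Complex_Main "HOL-Library.Sublist" "HOL-Library.Extended_Real"
begin

(* The ordered set of reals extended by an element \<alpha>\<^sup>+ immediately above every real \<alpha>:
   Rl \<alpha> stands for \<alpha>, Pl \<alpha> for \<alpha>\<^sup>+. *)
datatype hreal = Rl real | Pl real

instantiation hreal :: linorder
begin

fun less_hreal :: "hreal \<Rightarrow> hreal \<Rightarrow> bool" where
  "less_hreal (Rl a) (Rl b) \<longleftrightarrow> a < b"
| "less_hreal (Rl a) (Pl b) \<longleftrightarrow> a \<le> b"
| "less_hreal (Pl a) (Rl b) \<longleftrightarrow> a < b"
| "less_hreal (Pl a) (Pl b) \<longleftrightarrow> a < b"

definition less_eq_hreal :: "hreal \<Rightarrow> hreal \<Rightarrow> bool" where
  "less_eq_hreal x y \<longleftrightarrow> x < y \<or> x = y"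

instance
proof
  fix x y z :: hreal
  show "(x < y) = (x \<le> y \<and> \<not> y \<le> x)"
    by (cases x; cases y) (auto simp: less_eq_hreal_def)
  show "x \<le> x"
    by (simp add: less_eq_hreal_def)
  show "x \<le> y \<Longrightarrow> y \<le> z \<Longrightarrow> x \<le> z"
    by (cases x; cases y; cases z) (auto simp: less_eq_hreal_def)
  show "x \<le> y \<Longrightarrow> y \<le> x \<Longrightarrow> x = y"
    by (cases x; cases y) (auto simp: less_eq_hreal_def)
  show "x \<le> y \<or> y \<le> x"
    by (cases x; cases y) (auto simp: less_eq_hreal_def)
qed

end

datatype 'a fiword = Fin "'a list" | Inf "nat \<Rightarrow> 'a"

fun is_factor :: "'a list \<Rightarrow> 'a fiword \<Rightarrow> bool" where
  "is_factor x (Fin u) \<longleftrightarrow> sublist x u"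
| "is_factor x (Inf s) \<longleftrightarrow> (\<exists>i j. x = map s [i..<j])"

definition is_period :: "nat \<Rightarrow> 'a list \<Rightarrow> bool" where
  "is_period p w \<longleftrightarrow> 1 \<le> p \<and> p \<le> length w \<and> (\<forall>i < length w - p. w ! i = w ! (i + p))"

(* Meaningful for nonempty words only, as is word_exp. *)
definition per :: "'a list \<Rightarrow> nat" where
  "per w = (LEAST p. is_period p w)"

definition word_exp :: "'a list \<Rightarrow> real" where
  "word_exp w = real (length w) / real (per w)"

(* Extended reals, since the supremum may be infinite; the empty word gets the value -\<infinity>. *)
definition cexp :: "'a fiword \<Rightarrow> ereal" where
  "cexp w = (SUP x \<in> {x. is_factor x w \<and> x \<noteq> []}. ereal (word_exp x))"

fun free_word :: "hreal \<Rightarrow> 'a fiword \<Rightarrow> bool" where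
  "free_word (Rl \<alpha>) w \<longleftrightarrow> cexp w < ereal \<alpha>"
| "free_word (Pl \<alpha>) w \<longleftrightarrow> cexp w \<le> ereal \<alpha>"

definition morphism :: "('a list \<Rightarrow> 'b list) \<Rightarrow> bool" where
  "morphism h \<longleftrightarrow> (\<forall>x y. h (x @ y) = h x @ h y)"

(* Extension of a morphism to infinite words: the limit of the images of the finite prefixes.
   It is finite if these images stabilize, which an erasing morphism can cause. *)
fun morph_image :: "('a list \<Rightarrow> 'b list) \<Rightarrow> 'a fiword \<Rightarrow> 'b fiword" where
  "morph_image h (Fin u) = Fin (h u)"
| "morph_image h (Inf s) =
    (if \<forall>i. \<exists>n. i < length (h (map s [0..<n]))
     then Inf (\<lambda>i. h (map s [0..<(LEAST n. i < length (h (map s [0..<n])))]) ! i)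
     else Fin (h (map s [0..<(LEAST n. \<forall>m\<ge>n. h (map s [0..<m]) = h (map s [0..<n]))])))"

definition free_morphism :: "hreal \<Rightarrow> ('a list \<Rightarrow> 'b list) \<Rightarrow> bool" where
  "free_morphism \<alpha> h \<longleftrightarrow>
     morphism h \<and> (\<forall>w. free_word \<alpha> w \<longrightarrow> free_word \<alpha> (morph_image h w))"

definition uniform_morphism :: "nat \<Rightarrow> ('a list \<Rightarrow> 'b list) \<Rightarrow> bool" where
  "uniform_morphism k h \<longleftrightarrow> morphism h \<and> (\<forall>a. length (h [a]) = k)"

(* The binary alphabet is bool, with False for 0 and True for 1. *)
definition complement :: "bool list \<Rightarrow> bool list" where
  "complement w = map Not w"

definition complementary :: "(bool list \<Rightarrow> bool list) \<Rightarrow> bool" where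
  "complementary h \<longleftrightarrow> (\<exists>k. uniform_morphism k h) \<and> h [True] = complement (h [False])"

lemma length_uniform_morphism:
  assumes "uniform_morphism k h"
  shows "length (h u) = k * length u"
proof (induction u)
  case Nil
  have "h ([] @ []) = h [] @ h []"
    using assms unfolding uniform_morphism_def morphism_def by blast
  then show ?case by simp
next
  case (Cons a u)
  have "h ([a] @ u) = h [a] @ h u" "length (h [a]) = k"
    using assms unfolding uniform_morphism_def morphism_def by blast+
  then show ?case using Cons by simp
qed

lemma morph_image_uniform:
  assumes "uniform_morphism k h" "k \<ge> 1"
  shows "morph_image h (Inf s) = Inf (\<lambda>i. h [s (i div k)] ! (i mod k))"
proof -
  have len: "length (h (map s [0..<n])) = k * n" for n
    by (simp add: length_uniform_morphism[OF assms(1)])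
  have ex: "\<forall>i. \<exists>n. i < length (h (map s [0..<n]))"
  proof
    fix i
    have "i < k * Suc i" using assms(2) by (cases k) auto
    then show "\<exists>n. i < length (h (map s [0..<n]))" unfolding len by blast
  qed
  have "h (map s [0..<(LEAST n. i < length (h (map s [0..<n])))]) ! i = h [s (i div k)] ! (i mod k)" for i
  proof -
    have L: "(LEAST n. i < length (h (map s [0..<n]))) = Suc (i div k)"
      unfolding len
    proof (rule Least_equality)
      show "i < k * Suc (i div k)" using assms(2) by (simp add: dividend_less_times_div)
    next
      fix n assume "i < k * n"
      then have "i div k < n" using assms(2) by (simp add: less_mult_imp_div_less mult.commute)
      then show "Suc (i div k) \<le> n" by simp
    qed
    have "h (map s [0..<Suc (i div k)]) = h (map s [0..<i div k]) @ h [s (i div k)]"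
      using assms(1) unfolding uniform_morphism_def morphism_def by simp
    moreover have "i = k * (i div k) + i mod k" by simp
    ultimately show ?thesis
      unfolding L by (metis len nth_append_length_plus)
  qed
  then show ?thesis using ex by simp
qed

end

theory Submission
  imports Defs
begin

text \<open>
  A single morphism of length $k$ serves every \<open>\<alpha>\<close> at once: it satisfies
  \<open>cexp (h w) \<le> max 3 (cexp w)\<close> for all words \<open>w\<close>.

  The images of the two letters differ at every position. Suppose that a factor of \<open>h w\<close> has a
  period \<open>k q\<close> smaller than its length. Whenever two blocks at distance \<open>q\<close> share one pair of
  compared positions, they are images of the same letter; hence \<open>w\<close> has a factor of period \<open>q\<close>
  that consists of all blocks touched, and its exponent is at least as large
  (\<open>factor_exponent_descends\<close>). So it suffices to find an image \<open>U\<close> of the letter 0 that is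
  \<^emph>\<open>synchronizing\<close>: every factor of exponent greater than 3 in an image word has a period
  divisible by \<open>k\<close>.

  Synchronization comes from a marker, a pattern of three letters that can occur in
  image words at only one residue class of positions modulo \<open>k\<close>. A factor of length
  \<open>3 p + 1\<close> and period \<open>p\<close> is so long that each marker in it has a second copy at distance
  \<open>p\<close> inside it, so if \<open>k\<close> does not divide \<open>p\<close> it contains no marker at all and fits between
  two consecutive markers (\<open>marker_free_if_unsynchronized\<close>). There it has to be excluded by the
  choice of \<open>U\<close>. For \<open>k \<ge> 6\<close>, \<open>U\<close> is a prefix \<open>T\<close> of length \<open>k - 5\<close> of the Thue-Morse
  word with last letter \<open>c\<close>, followed by the marker \<open>c'c'c'\<close> and by \<open>cc'\<close>, where \<open>c'\<close> is the
  complement of \<open>c\<close>. The words \<open>cc'\<close> and \<open>c'c\<close> both extend \<open>T\<close> to the left within a factor of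
  the Thue-Morse word or of its complement, so what lies between two markers is
  overlap-free. Together with the two letters of a marker that can be attached at each end,
  it is still too poor for an exponent above 3 (\<open>no_overcube_between_markers\<close>). The lengths 2 to 5
  use 01 and prefixes of 00101 with shorter arguments of the same kind, and the length 1
  needs no argument.
\<close>

section \<open>Periods on intervals\<close>

text \<open>The bound \<open>m\<close> is inclusive, so that an overlap of period \<open>p\<close> is periodicity on the positions
  from \<open>l\<close> to \<open>l + 2 * p\<close>, and a word of length \<open>3 * p + 1\<close> is one from \<open>l\<close> to \<open>l + 3 * p\<close>.\<close>

definition periodic_on :: "(nat \<Rightarrow> 'a) \<Rightarrow> nat \<Rightarrow> nat \<Rightarrow> nat \<Rightarrow> bool" where
  "periodic_on f p l m \<longleftrightarrow> (\<forall>i. l \<le> i \<longrightarrow> i + p \<le> m \<longrightarrow> f i = f (i + p))"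

lemma periodic_onD: "periodic_on f p l m \<Longrightarrow> l \<le> i \<Longrightarrow> i + p \<le> m \<Longrightarrow> f i = f (i + p)"
  by (simp add: periodic_on_def)

lemma periodic_on_subinterval:
  "periodic_on f p l m \<Longrightarrow> l \<le> l' \<Longrightarrow> m' \<le> m \<Longrightarrow> periodic_on f p l' m'"
  by (auto simp: periodic_on_def)

lemma periodic_on_shift:
  assumes "periodic_on f p (a + l) (a + m)" and "\<And>i. l \<le> i \<Longrightarrow> i \<le> m \<Longrightarrow> g i = f (a + i)"
  shows "periodic_on g p l m"
  unfolding periodic_on_def
proof (intro allI impI)
  fix i assume "l \<le> i" "i + p \<le> m"
  then show "g i = g (i + p)"
    using periodic_onD[OF assms(1), of "a + i"] assms(2)[of i] assms(2)[of "i + p"]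
    by (simp add: add.assoc)
qed

lemma alternating_odd_distance:
  fixes f :: "nat \<Rightarrow> bool"
  assumes "\<And>i. i < p \<Longrightarrow> f (l + i) \<noteq> f (l + Suc i)" and "odd p"
  shows "f (l + p) \<noteq> f l"
proof -
  have "i \<le> p \<Longrightarrow> f (l + i) = (f l \<noteq> odd i)" for i
    by (induction i) (use assms(1) in \<open>auto simp: less_eq_Suc_le\<close>)
  then show ?thesis using assms(2) by auto
qed

section \<open>The Thue-Morse word\<close>

fun thue_morse :: "nat \<Rightarrow> bool" where
  "thue_morse n = (if n = 0 then False else thue_morse (n div 2) \<noteq> odd n)"

declare thue_morse.simps [simp del]

lemma thue_morse_0 [simp]: "thue_morse 0 = False"
  by (simp add: thue_morse.simps)

lemma thue_morse_double [simp]: "thue_morse (2 * n) = thue_morse n"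
  by (cases "n = 0") (simp_all add: thue_morse.simps[of "2 * n"])

lemma thue_morse_Suc_double [simp]: "thue_morse (Suc (2 * n)) = (\<not> thue_morse n)"
  by (simp add: thue_morse.simps[of "Suc (2 * n)"])

lemma thue_morse_even_pair: "even j \<Longrightarrow> thue_morse j \<noteq> thue_morse (Suc j)"
  by (auto elim!: evenE)

text \<open>
  An even period is halved, since the letters at positions of one parity form the
  Thue-Morse word or its complement. For an odd period, two equal neighbours
  would reappear at distance \<open>p\<close> with the other parity, but equal neighbours start only at odd
  positions. Hence the word alternates over one period, and its letters at distance \<open>p\<close> differ.
\<close>

lemma thue_morse_overlap_free:
  "p \<ge> 1 \<Longrightarrow> \<not> periodic_on thue_morse p l (l + 2 * p)"
proof (induction p arbitrary: l rule: less_induct)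
  case (less p)
  show ?case
  proof
    assume per: "periodic_on thue_morse p l (l + 2 * p)"
    show False
    proof (cases "even p")
      case True
      then obtain q where q: "p = 2 * q" by (auto elim: evenE)
      have "periodic_on thue_morse q (l div 2) (l div 2 + 2 * q)"
        unfolding periodic_on_def
      proof (intro allI impI)
        \<comment> \<open>Position \<open>i\<close> is read off at the position \<open>2 * i\<close> or \<open>2 * i + 1\<close> of the parity of \<open>l\<close>.\<close>
        fix i assume i: "l div 2 \<le> i" "i + q \<le> l div 2 + 2 * q"
        have "2 * (l div 2) + l mod 2 = l" by simp
        then have "l \<le> 2 * i + l mod 2" "2 * i + l mod 2 + p \<le> l + 2 * p"
          using i q by linarith+
        then have "thue_morse (2 * i + l mod 2) = thue_morse (2 * i + l mod 2 + p)"
          by (rule periodic_onD[OF per])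
        moreover have "2 * i + l mod 2 + p = 2 * (i + q) + l mod 2" using q by simp
        ultimately show "thue_morse i = thue_morse (i + q)"
          using thue_morse_double[of i] thue_morse_double[of "i + q"]
            thue_morse_Suc_double[of i] thue_morse_Suc_double[of "i + q"]
          by (cases "l mod 2 = 0") (simp_all del: distrib_left_numeral)
      qed
      with less.IH[of q] less.prems q show False by auto
    next
      case False
      have "thue_morse (l + i) \<noteq> thue_morse (l + Suc i)" if "i < p" for i
      proof (cases "even (l + i)")
        case True
        then show ?thesis using thue_morse_even_pair by simp
      next
        case odd: False
        with False have "even (l + i + p)" by simp
        then have "thue_morse (l + i + p) \<noteq> thue_morse (l + Suc i + p)"
          using thue_morse_even_pair[of "l + i + p"] by simp
        then show ?thesis
          using periodic_onD[OF per, of "l + i"] periodic_onD[OF per, of "l + Suc i"] that by simp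
      qed
      from alternating_odd_distance[OF this False] periodic_onD[OF per, of l]
      show False by simp
    qed
  qed
qed

lemma thue_morse_add_power: "i < 2 ^ m \<Longrightarrow> thue_morse (2 ^ m + i) = (\<not> thue_morse i)"
proof (induction m arbitrary: i)
  case 0
  then show ?case using thue_morse_Suc_double[of 0] by simp
next
  case (Suc m)
  then have IH: "thue_morse (2 ^ m + i div 2) = (\<not> thue_morse (i div 2))" by simp
  show ?case
  proof (cases "even i")
    case True
    then obtain j where "i = 2 * j" by (auto elim: evenE)
    then show ?thesis
      using IH thue_morse_double[of j] thue_morse_double[of "2 ^ m + j"] by simp
  next
    case False
    then obtain j where "i = Suc (2 * j)" by (auto elim: oddE)
    then show ?thesis
      using IH thue_morse_Suc_double[of j] thue_morse_Suc_double[of "2 ^ m + j"] by simp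
  qed
qed

lemma thue_morse_power_minus_1: "thue_morse (2 ^ m - 1) = odd m"
proof (induction m)
  case (Suc m)
  have "(2::nat) ^ m \<ge> 1" by simp
  then have "2 ^ Suc m - 1 = Suc (2 * (2 ^ m - 1 :: nat))"
    unfolding power_Suc by linarith
  then show ?case using Suc by simp
qed simp

text \<open>
  The complement of a prefix starts at every position \<open>2 ^ m\<close> with \<open>m\<close> large. The
  two letters before it are the end of the block of length \<open>2 ^ m\<close>, which is 01 or 10 according
  to the parity of \<open>m\<close>. So both occur, and this lets \<open>marked_thue_morse\<close> put either of
  them between a marker and the next block.
\<close>

lemma thue_morse_prefix_left_context:
  "\<exists>a. thue_morse a = (\<not> b) \<and> thue_morse (a + 1) = b \<and>
       (\<forall>i<n. thue_morse (a + 2 + i) = (\<not> thue_morse i))"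
proof -
  obtain m where m: "m \<ge> Suc n" "odd m = b"
  proof
    define m where "m = (if odd (Suc n) = b then Suc n else Suc (Suc n))"
    show "m \<ge> Suc n" "odd m = b" by (auto simp: m_def)
  qed
  have "n < 2 ^ m" using m by (meson Suc_leD le_less_trans less_exp order.refl le_trans)
  moreover have "2 ^ m \<ge> (2::nat)" using m by (cases m) auto
  moreover define a where "a = (2 ^ m - 2 :: nat)"
  ultimately have a: "a + 2 = 2 ^ m" "even a" "n < 2 ^ m" "a + 1 = 2 ^ m - 1"
    using m(1) by auto
  show ?thesis
  proof (intro exI[of _ a] conjI allI impI)
    show "thue_morse (a + 1) = b"
      using thue_morse_power_minus_1[of m] m(2) a(4) by simp
    then show "thue_morse a = (\<not> b)"
      using thue_morse_even_pair[OF a(2)] by simp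
    show "thue_morse (a + 2 + i) = (\<not> thue_morse i)" if "i < n" for i
      unfolding a(1) using thue_morse_add_power[of i m] a(3) that by simp
  qed
qed

section \<open>Images under complementary morphisms\<close>

text \<open>
  The image of the sequence \<open>s\<close> under the complementary morphism of length \<open>k\<close> that sends
  \<open>False\<close> to \<open>U 0, ..., U (k - 1)\<close>. Comparing with a letter by \<open>\<noteq>\<close> complements exactly under \<open>True\<close>.
\<close>

definition letterwise_image :: "nat \<Rightarrow> (nat \<Rightarrow> bool) \<Rightarrow> (nat \<Rightarrow> bool) \<Rightarrow> nat \<Rightarrow> bool" where
  "letterwise_image k U s i \<longleftrightarrow> U (i mod k) \<noteq> s (i div k)"

text \<open>
  The shortest words of exponent greater than 3 and period \<open>p\<close> have length \<open>3 * p + 1\<close>, and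
  it suffices to control these.
\<close>

definition synchronizing :: "nat \<Rightarrow> (nat \<Rightarrow> bool) \<Rightarrow> bool" where
  "synchronizing k U \<longleftrightarrow>
     (\<forall>s l p. p \<ge> 1 \<longrightarrow> periodic_on (letterwise_image k U s) p l (l + 3 * p) \<longrightarrow> k dvd p)"

text \<open>
  The predicate \<open>P\<close> describes the marker. A marker inside the factor can be moved by the period
  either to the right or to the left without leaving the factor; both copies start in the
  residue class \<open>r\<close>, so the period would be a multiple of \<open>k\<close>.
\<close>

lemma marker_free_if_unsynchronized:
  assumes marker: "\<And>i. P (f i) (f (i + 1)) (f (i + 2)) \<Longrightarrow> i mod k = r"
    and per: "periodic_on f p l (l + 3 * p)" and "p \<ge> 1" and "\<not> k dvd p"
    and "l \<le> i" "i + 2 \<le> l + 3 * p"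
  shows "\<not> P (f i) (f (i + 1)) (f (i + 2))"
proof
  assume P: "P (f i) (f (i + 1)) (f (i + 2))"
  have "\<exists>j. P (f j) (f (j + 1)) (f (j + 2)) \<and> P (f (j + p)) (f (j + p + 1)) (f (j + p + 2))"
  proof (cases "i + 2 \<le> l + 2 * p")
    case True
    then have "f i = f (i + p)" "f (i + 1) = f (i + p + 1)" "f (i + 2) = f (i + p + 2)"
      using periodic_onD[OF per, of i] periodic_onD[OF per, of "i + 1"]
        periodic_onD[OF per, of "i + 2"] assms(5) by (simp_all add: add_ac)
    with P show ?thesis by metis
  next
    case False
    define j where "j = i - p"
    have j: "i = j + p" "l \<le> j" using False assms(3) by (auto simp: j_def)
    then have "f j = f (j + p)" "f (j + 1) = f (j + p + 1)" "f (j + 2) = f (j + p + 2)"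
      using periodic_onD[OF per, of j] periodic_onD[OF per, of "j + 1"]
        periodic_onD[OF per, of "j + 2"] assms(6) by (simp_all add: add_ac)
    with P show ?thesis unfolding j(1) by metis
  qed
  then obtain j where "j mod k = r" "(j + p) mod k = r" using marker by blast
  then have "k dvd (j + p) - j" by (metis le_add1 mod_eq_dvd_iff_nat)
  with assms(4) show False by simp
qed

text \<open>
  For the Thue-Morse morphism the marker is a pair of equal neighbours. Without markers
  the factor alternates, which is impossible for an odd period.
\<close>

lemma synchronizing_2: "synchronizing 2 (\<lambda>j. j = 1)"
  unfolding synchronizing_def
proof (intro allI impI, rule ccontr)
  fix s l and p :: nat
  define f where "f = letterwise_image 2 (\<lambda>j. j = 1) s"
  assume p: "p \<ge> 1" and "periodic_on (letterwise_image 2 (\<lambda>j. j = 1) s) p l (l + 3 * p)"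
    and ndvd: "\<not> 2 dvd p"
  then have per: "periodic_on f p l (l + 3 * p)" by (simp add: f_def)
  have marker: "i mod 2 = 1" if "f i = f (i + 1)" for i
  proof (rule ccontr)
    assume "i mod 2 \<noteq> 1"
    then have "(i + 1) mod 2 = 1" "i mod 2 = 0" "(i + 1) div 2 = i div 2" by presburger+
    with that show False by (simp add: f_def letterwise_image_def)
  qed
  have "f (l + i) \<noteq> f (l + Suc i)" if "i < p" for i
    using marker_free_if_unsynchronized[where P = "\<lambda>a b c. a = b" and f = f,
        OF marker per p ndvd, of "l + i"] that
    by simp
  from alternating_odd_distance[OF this ndvd] periodic_onD[OF per, of l]
  show False by simp
qed

lemma letterwise_image_step:
  assumes "j < k"
  shows "letterwise_image k U s (k * b + j) = (U j \<noteq> s b)"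
  using assms by (simp add: letterwise_image_def)

lemma letterwise_image_add:
  assumes "k \<ge> 1" and "d \<le> k"
  shows "letterwise_image k U s (i + d) =
    (if i mod k + d < k then U (i mod k + d) \<noteq> s (i div k)
     else U (i mod k + d - k) \<noteq> s (Suc (i div k)))"
proof (cases "i mod k + d < k")
  case True
  have "k * (i div k) + (i mod k + d) = i + d" by simp
  then show ?thesis using letterwise_image_step[OF True, of U s "i div k"] True by simp
next
  case False
  have "k * Suc (i div k) + (i mod k + d - k) = k * (i div k) + i mod k + d" using False by simp
  also have "\<dots> = i + d" by simp
  finally have "k * Suc (i div k) + (i mod k + d - k) = i + d" .
  moreover have "i mod k < k" using assms(1) by simp
  then have "i mod k + d - k < k" using assms(2) by linarith
  ultimately show ?thesis
    using letterwise_image_step[of "i mod k + d - k" k U s "Suc (i div k)"] False by simp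
qed

text \<open>
  The images are the prefixes of 00101, and the markers are 001 and 110, which occur only at the
  start of a block. A factor without markers has length at most \<open>k + 1 \<le> 6\<close>, which leaves only
  the period 1, and no letter occurs four times in a row.
\<close>

lemma synchronizing_3_4_5:
  assumes "k \<in> {3, 4, 5}"
  shows "synchronizing k (\<lambda>j. j = 2 \<or> j = 4)"
  unfolding synchronizing_def
proof (intro allI impI, rule ccontr)
  fix s l and p :: nat
  define U where "U = (\<lambda>j::nat. j = 2 \<or> j = 4)"
  define f where "f = letterwise_image k U s"
  assume p: "p \<ge> 1" and "periodic_on (letterwise_image k (\<lambda>j. j = 2 \<or> j = 4) s) p l (l + 3 * p)"
    and ndvd: "\<not> k dvd p"
  then have per: "periodic_on f p l (l + 3 * p)" by (simp add: f_def U_def)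
  have k0: "k > 0" using assms by auto
  have at: "f (i + d) = (if i mod k + d < k then U (i mod k + d) \<noteq> s (i div k)
      else U (i mod k + d - k) \<noteq> s (Suc (i div k)))" if "d \<le> 3" for i d
    unfolding f_def by (rule letterwise_image_add) (use assms that in auto)
  have residue: "k = 3 \<and> j \<in> {0, 1, 2} \<or> k = 4 \<and> j \<in> {0, 1, 2, 3} \<or> k = 5 \<and> j \<in> {0, 1, 2, 3, 4}"
    if "j < k" for j
    using assms that by (auto simp: numeral_eq_Suc less_Suc_eq)
  have marker: "i mod k = 0" if m: "f i = f (i + 1) \<and> f (i + 1) \<noteq> f (i + 2)" for i
  proof -
    define j x y where "j = i mod k" and "x = s (i div k)" and "y = s (Suc (i div k))"
    then have jk: "j < k" using k0 by simp
    have "f i = (if j < k then U j \<noteq> x else U (j - k) \<noteq> y)"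
      "f (i + 1) = (if j + 1 < k then U (j + 1) \<noteq> x else U (j + 1 - k) \<noteq> y)"
      "f (i + 2) = (if j + 2 < k then U (j + 2) \<noteq> x else U (j + 2 - k) \<noteq> y)"
      using at[of 0 i] at[of 1 i] at[of 2 i] by (simp_all add: j_def x_def y_def)
    then show ?thesis
      using m residue[OF jk] unfolding j_def[symmetric] by (elim disjE conjE insertE emptyE; simp add: U_def)
  qed
  have no_marker: "\<not> (f i = f (i + 1) \<and> f (i + 1) \<noteq> f (i + 2))" if "l \<le> i" "i + 2 \<le> l + 3 * p" for i
    using marker_free_if_unsynchronized[where P = "\<lambda>a b c. a = b \<and> b \<noteq> c" and f = f,
        OF marker per p ndvd that] .
  have block: "f (k * b) = f (k * b + 1) \<and> f (k * b + 1) \<noteq> f (k * b + 2)" for b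
    using at[of 0 "k * b"] at[of 1 "k * b"] at[of 2 "k * b"] k0 assms by (auto simp: U_def)
  have "p = 1"
  proof (rule ccontr)
    assume "p \<noteq> 1"
    then have "p \<ge> 2" using p by simp
    \<comment> \<open>The first block boundary at or after \<open>l\<close> already carries a forbidden marker.\<close>
    obtain b where "l \<le> k * b" "k * b < l + k"
    proof
      have "k * ((l + k - 1) div k) + (l + k - 1) mod k = l + k - 1" by simp
      moreover have "(l + k - 1) mod k < k" using k0 by simp
      ultimately show "l \<le> k * ((l + k - 1) div k)" "k * ((l + k - 1) div k) < l + k"
        using k0 by linarith+
    qed
    moreover have "k \<le> 5" using assms by auto
    ultimately have "l \<le> k * b" "k * b + 2 \<le> l + 3 * p" using \<open>p \<ge> 2\<close> by linarith+
    then show False using no_marker block by blast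
  qed
  then have "f l = f (l + 1)" "f (l + 1) = f (l + 2)" "f (l + 2) = f (l + 3)"
    using periodic_onD[OF per, of l] periodic_onD[OF per, of "l + 1"]
      periodic_onD[OF per, of "l + 2"] by (simp_all add: numeral_eq_Suc)
  moreover define j x y where "j = l mod k" and "x = s (l div k)" and "y = s (Suc (l div k))"
  then have jk: "j < k" using k0 by simp
  moreover have "f l = (if j < k then U j \<noteq> x else U (j - k) \<noteq> y)"
    "f (l + 1) = (if j + 1 < k then U (j + 1) \<noteq> x else U (j + 1 - k) \<noteq> y)"
    "f (l + 2) = (if j + 2 < k then U (j + 2) \<noteq> x else U (j + 2 - k) \<noteq> y)"
    "f (l + 3) = (if j + 3 < k then U (j + 3) \<noteq> x else U (j + 3 - k) \<noteq> y)"
    using at[of 0 l] at[of 1 l] at[of 2 l] at[of 3 l] by (simp_all add: j_def x_def y_def)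
  ultimately show False
    using residue[OF jk] by (elim disjE conjE insertE emptyE; simp add: U_def)
qed

text \<open>
  The word \<open>T c'c'c' cc'\<close> of length \<open>n + 5\<close>, where \<open>T\<close> is the Thue-Morse prefix of length \<open>n\<close>,
  \<open>c\<close> is its last letter and \<open>c'\<close> the complement of \<open>c\<close>. The cube of \<open>c'\<close> is the marker. It cannot
  be longer or begin elsewhere: \<open>T\<close> ends in \<open>c\<close>, and \<open>cc'\<close> protects the next block, whose
  first two letters are unequal.
\<close>

definition marked_thue_morse :: "nat \<Rightarrow> nat \<Rightarrow> bool" where
  "marked_thue_morse n j =
     (if j < n then thue_morse j
      else if j = n + 3 then thue_morse (n - 1) else \<not> thue_morse (n - 1))"

text \<open>
  The word \<open>g\<close> is what lies between two consecutive markers, with two letters of the markers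
  at each end: \<open>dd d'd T' xx\<close>, where \<open>T'\<close> is a Thue-Morse prefix or its complement and \<open>x\<close> differs
  from the last letter of \<open>T'\<close>. The part \<open>d'd T'\<close> is overlap-free. A factor of
  length \<open>3 p + 1\<close> therefore reaches over the ends of this part by at least \<open>p + 1\<close> of the four
  additional letters, so \<open>p \<le> 3\<close>. The remaining cases are refuted by a few letters at the ends,
  because such a factor with \<open>p \<ge> 2\<close> reaches over both ends, which leaves few positions for it.
\<close>

lemma no_overcube_between_markers:
  fixes g :: "nat \<Rightarrow> bool"
  assumes start: "g 1 = g 0" "g 2 \<noteq> g 0" "g 3 = g 0"
    and core: "\<And>i. i < n \<Longrightarrow> g (4 + i) = (thue_morse i \<noteq> e)"
    and end_: "g (n + 4) \<noteq> g (n + 3)" "g (n + 5) \<noteq> g (n + 3)"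
    and p: "p \<ge> 1" and per: "periodic_on g p l (l + 3 * p)" and range: "l + 3 * p \<le> n + 5"
  shows False
proof -
  have overlap: False if "q \<ge> 1" "2 \<le> a" "a + 2 * q \<le> n + 3" "periodic_on g q a (a + 2 * q)" for q a
  proof -
    \<comment> \<open>An occurrence at \<open>z\<close> of \<open>d'd T'\<close> or of its complement in the Thue-Morse word.\<close>
    obtain z where z: "thue_morse z = (\<not> (g 0 = e))" "thue_morse (z + 1) = (g 0 = e)"
      "\<And>i. i < n \<Longrightarrow> thue_morse (z + 2 + i) = (\<not> thue_morse i)"
      using thue_morse_prefix_left_context[of "g 0 = e" n] by blast
    have "thue_morse (z + i) = (g (2 + i) = e)" if "i \<le> n + 1" for i
    proof (cases "i < 2")
      case True
      then have "i = 0 \<or> i = 1" by auto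
      then show ?thesis using z(1,2) start by (auto simp: numeral_3_eq_3 numeral_2_eq_2)
    next
      case False
      then obtain i' where i': "i = 2 + i'" by (metis le_add_diff_inverse not_less)
      then have "z + i = z + 2 + i'" "2 + i = 4 + i'" "i' < n" using that by simp_all
      then show ?thesis using z(3)[of i'] core[of i'] by metis
    qed
    note tm = this
    have "periodic_on thue_morse q (z + (a - 2)) (z + (a - 2) + 2 * q)"
      unfolding periodic_on_def
    proof (intro allI impI)
      fix i assume i: "z + (a - 2) \<le> i" "i + q \<le> z + (a - 2) + 2 * q"
      define j where "j = i - z"
      have "i = z + j" "a \<le> 2 + j" "2 + j + q \<le> a + 2 * q" using i that by (auto simp: j_def)
      then show "thue_morse i = thue_morse (i + q)"
        using periodic_onD[OF that(4), of "2 + j"] tm[of j] tm[of "j + q"] that(3)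
        by (simp add: add.assoc)
    qed
    then show False using thue_morse_overlap_free that(1) by blast
  qed
  have eq: "g i = g (i + p)" if "l \<le> i" "i \<le> l + 2 * p" for i
    using periodic_onD[OF per, of i] that by simp
  show False
  proof (cases "l \<ge> 2")
    case True
    show False
    proof (cases "l + 2 * p \<le> n + 3")
      case True
      then show False
        using overlap[OF p \<open>l \<ge> 2\<close>] periodic_on_subinterval[OF per] by simp
    next
      case False
      then have "p = 1" "l = n + 2" using p range by linarith+
      then show False using eq[of "n + 3"] end_ by (simp add: numeral_eq_Suc)
    qed
  next
    case False
    then have l: "l = 0 \<or> l = 1" by auto
    consider "p = 1" | "p \<ge> 2" "2 + 2 * p \<le> n + 3" | "p \<ge> 2" "n + 2 \<le> 2 * p"
      using p by linarith
    then show False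
    proof cases
      case 1
      then show False using eq[of 1] l start by (auto simp: numeral_eq_Suc)
    next
      case 2
      then show False
        using overlap[OF p _ 2(2)] periodic_on_subinterval[OF per, of 2 "2 + 2 * p"] l by auto
    next
      case 3
      from 3(2) range have "l + p \<le> 3" by linarith
      with l 3(1) consider "l = 0" "p = 2" | "l = 1" "p = 2" | "l = 0" "p = 3" by linarith
      then show False
      proof cases
        case 1
        then show False using eq[of 0] start by (simp add: numeral_eq_Suc)
      next
        case 2
        then have "n = 2" using 3(2) range by linarith
        with 2 show False using eq[of 5] end_ by (simp add: numeral_eq_Suc)
      next
        case 3
        then have "n = 4" using \<open>n + 2 \<le> 2 * p\<close> range by linarith
        with 3 show False using eq[of 0] eq[of 3] eq[of 6] eq[of 1] eq[of 4] start end_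
          by (simp add: numeral_eq_Suc)
      qed
    qed
  qed
qed

lemma marked_thue_morse_marker:
  fixes s :: "nat \<Rightarrow> bool"
  assumes n: "n \<ge> 1" and k: "k = n + 5" and f: "f = letterwise_image k (marked_thue_morse n) s"
    and cube: "f i = f (i + 1)" "f (i + 1) = f (i + 2)"
  shows "i mod k = n"
proof -
  let ?U = "marked_thue_morse n"
  define b j where "b = i div k" and "j = i mod k"
  have "k \<ge> 1" and j: "j < k" using k unfolding j_def by simp_all
  note add = letterwise_image_add[OF \<open>k \<ge> 1\<close>, of _ ?U s i, folded f j_def b_def]
  have here: "f (i + d) = (?U (j + d) \<noteq> s b)" if "j + d < k" for d
    using add[of d] that by simp
  have nxt: "f (i + d) = (?U (j + d - k) \<noteq> s (Suc b))" if "k \<le> j + d" "d \<le> k" for d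
    using add[of d] that by simp
  have U01: "?U j = ?U (j + 1)" if "j + 1 < k"
    using here[of 0] here[of 1] cube(1) that by auto
  have U12: "?U (j + 1) = ?U (j + 2)" if "j + 2 < k"
    using here[of 1] here[of 2] cube(2) that by auto
  show ?thesis
  proof (rule ccontr)
    assume "i mod k \<noteq> n"
    then have jn: "j \<noteq> n" by (simp add: j_def)
    consider "j + 1 = k" | "j + 2 < n" | "j + 2 = n" | "j + 1 = n" | "j = n + 1" | "j = n + 2" | "j = n + 3"
      using j jn k by linarith
    then show False
    proof cases
      case 1
      have "?U 0 \<noteq> ?U 1"
        using n thue_morse_even_pair[of 0] by (cases "n = 1") (auto simp: marked_thue_morse_def)
      moreover have "j + 1 - k = 0" "j + 2 - k = 1" "2 \<le> k" using 1 k by linarith+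
      ultimately show False
        using nxt[of 1] nxt[of 2] cube(2) 1 by auto
    next
      case 2
      have "\<not> periodic_on thue_morse 1 j (j + 2 * 1)" by (rule thue_morse_overlap_free) simp
      then have "\<not> (thue_morse j = thue_morse (j + 1) \<and> thue_morse (j + 1) = thue_morse (j + 2))"
        by (auto simp: periodic_on_def le_Suc_eq numeral_2_eq_2)
      then show False using 2 U01 U12 k by (auto simp: marked_thue_morse_def)
    next
      case 3
      then have "n - 1 = j + 1" "j + 2 < k" using k by linarith+
      then show False using U12 3 by (simp add: marked_thue_morse_def)
    next
      case 4
      then have "n - 1 = j" "j + 1 < k" using k by linarith+
      then show False using U01 4 by (simp add: marked_thue_morse_def)
    next
      case 5
      then show False using U12 k by (simp add: marked_thue_morse_def)
    next
      case 6
      then show False using U01 k by (simp add: marked_thue_morse_def)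
    next
      case 7
      then show False using U01 k by (simp add: marked_thue_morse_def)
    qed
  qed
qed

lemma synchronizing_marked_thue_morse:
  assumes n: "n \<ge> 1" and k: "k = n + 5"
  shows "synchronizing k (marked_thue_morse n)"
  unfolding synchronizing_def
proof (intro allI impI, rule ccontr)
  fix s l and p :: nat
  let ?U = "marked_thue_morse n"
  assume p: "p \<ge> 1" and per0: "periodic_on (letterwise_image k ?U s) p l (l + 3 * p)"
    and ndvd: "\<not> k dvd p"
  \<comment> \<open>Prepending a letter to \<open>s\<close> ensures that there is a marker before the factor.\<close>
  define f where "f = letterwise_image k ?U (\<lambda>i. s (i - 1))"
  define l' where "l' = k + l"
  have "k > 0" using k by simp
  then have shift: "letterwise_image k ?U s i = f (i + k)" for i
    unfolding f_def letterwise_image_def by simp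
  have per: "periodic_on f p l' (l' + 3 * p)"
    unfolding periodic_on_def
  proof (intro allI impI)
    fix i assume "l' \<le> i" "i + p \<le> l' + 3 * p"
    then obtain j where j: "i = j + k" "l \<le> j" "j + p \<le> l + 3 * p"
      using that[of "i - k"] by (simp add: l'_def)
    then show "f i = f (i + p)"
      using periodic_onD[OF per0 j(2,3)] shift[of j] shift[of "j + p"]
      by (simp add: add.assoc add.commute[of p k])
  qed
  have no_marker: "\<not> (f i = f (i + 1) \<and> f (i + 1) = f (i + 2))"
    if "l' \<le> i" "i + 2 \<le> l' + 3 * p" for i
    using marker_free_if_unsynchronized[where P = "\<lambda>a b c. a = b \<and> b = c" and f = f and r = n,
        OF _ per p ndvd that]
      marked_thue_morse_marker[OF n k f_def] by blast
  have at: "f (k * b + j) = (?U j \<noteq> s (b - 1))" if "j < k" for b j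
    using letterwise_image_step[OF that] by (simp add: f_def)
  have block: "f (k * b + n) = f (k * b + n + 1) \<and> f (k * b + n + 1) = f (k * b + n + 2)" for b
    using at[of n b] at[of "n + 1" b] at[of "n + 2" b] k by (simp add: marked_thue_morse_def)
  \<comment> \<open>The last marker that starts before \<open>l'\<close> is the one in block \<open>b\<close>, at \<open>a - 1\<close>. The factor ends
    before the marker of the next block is complete.\<close>
  define b where "b = (l' - (n + 1)) div k"
  define a where "a = k * b + n + 1"
  have a: "a \<le> l'" "l' < a + k"
  proof -
    have "k * b + (l' - (n + 1)) mod k = l' - (n + 1)" by (simp add: b_def)
    moreover have "(l' - (n + 1)) mod k < k" using \<open>k > 0\<close> by simp
    moreover have "l' \<ge> n + 1" using k by (simp add: l'_def)
    ultimately show "a \<le> l'" "l' < a + k" unfolding a_def by linarith+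
  qed
  have "l' + 3 * p \<le> a + (n + 5)"
  proof (rule ccontr)
    assume "\<not> ?thesis"
    moreover have "k * Suc b + n + 1 = a + k" by (simp add: a_def)
    ultimately have "l' \<le> k * Suc b + n" "k * Suc b + n + 2 \<le> l' + 3 * p" using a k by linarith+
    from no_marker[OF this] block[of "Suc b"] show False by blast
  qed
  define g where "g = (\<lambda>i. f (a + i))"
  define l0 where "l0 = l' - a"
  have "l' = a + l0" using a by (simp add: l0_def)
  then have perg: "periodic_on g p l0 (l0 + 3 * p)" and range: "l0 + 3 * p \<le> n + 5"
    using periodic_on_shift[of f p a l0 "l0 + 3 * p" g] per \<open>l' + 3 * p \<le> a + (n + 5)\<close>
    by (auto simp: g_def add.assoc)
  have gb: "g i = (?U (n + 1 + i) \<noteq> s (b - 1))" if "i < 4" for i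
    using at[of "n + 1 + i" b] that k unfolding g_def a_def by (simp only: add.assoc)
  have gn: "g (4 + i) = (?U i \<noteq> s b)" if "i < k" for i
  proof -
    have "a + (4 + i) = k * Suc b + i" by (simp add: a_def k)
    then have "f (a + (4 + i)) = (?U i \<noteq> s (Suc b - 1))" by (simp only: at[OF that])
    then show ?thesis by (simp add: g_def)
  qed
  show False
  proof (rule no_overcube_between_markers[OF _ _ _ _ _ _ p perg range, where e = "s b"])
    show "g 1 = g 0" "g 2 \<noteq> g 0" "g 3 = g 0"
      using gb[of 0] gb[of 1] gb[of 2] gb[of 3] by (auto simp: marked_thue_morse_def)
    show "g (4 + i) = (thue_morse i \<noteq> s b)" if "i < n" for i
      using gn[of i] that k by (simp add: marked_thue_morse_def)
    have "4 + (n - 1) = n + 3" using n by simp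
    then have "g (n + 3) = (thue_morse (n - 1) \<noteq> s b)"
      using gn[of "n - 1"] n k by (simp add: marked_thue_morse_def add.commute[of n 3])
    moreover have "g (n + 4) = (\<not> thue_morse (n - 1) \<noteq> s b)"
      using gn[of n] k by (simp add: marked_thue_morse_def add.commute)
    moreover have "g (n + 5) = (\<not> thue_morse (n - 1) \<noteq> s b)"
      using gn[of "n + 1"] k by (simp add: marked_thue_morse_def numeral_eq_Suc)
    ultimately show "g (n + 4) \<noteq> g (n + 3)" "g (n + 5) \<noteq> g (n + 3)" by auto
  qed
qed

lemma synchronizing_exists:
  assumes "k \<ge> 1"
  shows "\<exists>U. synchronizing k U"
proof -
  consider "k = 1" | "k = 2" | "k \<in> {3, 4, 5}" | n where "n \<ge> 1" "k = n + 5"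
    using assms by (cases "k \<ge> 6") (force dest: le_Suc_ex)+
  then show ?thesis
  proof cases
    case 1
    then show ?thesis by (simp add: synchronizing_def)
  next
    case 2
    then show ?thesis using synchronizing_2 by blast
  next
    case 3
    then show ?thesis using synchronizing_3_4_5 by blast
  next
    case 4
    then show ?thesis using synchronizing_marked_thue_morse by blast
  qed
qed

section \<open>Critical exponents of images\<close>

text \<open>
  Two blocks at distance \<open>q\<close> need only one compared pair of positions in common with the factor
  for their letters to agree, because the two letter images differ everywhere. The first
  and the last block may thus be covered in part only.
\<close>

lemma period_descends:
  assumes k: "k \<ge> 1" and "i < j" "k * q < j - i"
    and per: "periodic_on (letterwise_image k U s) (k * q) i (j - 1)"
  shows "periodic_on s q (i div k) ((j - 1) div k)"
  unfolding periodic_on_def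
proof (intro allI impI)
  fix b assume b: "i div k \<le> b" "b + q \<le> (j - 1) div k"
  \<comment> \<open>The first position of block \<open>b\<close> inside the factor.\<close>
  define m where "m = max i (k * b)"
  have "i < k * Suc b"
    using b(1) k by (metis div_less_iff_less_mult less_Suc_eq_le less_le_trans mult.commute zero_less_one)
  then have m: "k * b \<le> m" "m < k * b + k" using k by (auto simp: m_def)
  have "k * (b + q) \<le> j - 1"
    using b(2) k by (metis less_eq_div_iff_mult_less_eq less_le_trans mult.commute zero_less_one)
  then have "m + k * q \<le> j - 1" using assms(2,3) by (auto simp: m_def algebra_simps)
  then have "letterwise_image k U s m = letterwise_image k U s (m + k * q)"
    using periodic_onD[OF per] by (simp add: m_def)
  moreover have "m div k = b" using m k by (intro div_nat_eqI) (auto simp: mult.commute)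
  moreover have "(m + k * q) div k = m div k + q" "(m + k * q) mod k = m mod k" using k by auto
  ultimately show "s b = s (b + q)" by (auto simp: letterwise_image_def)
qed

lemma is_period_per: "w \<noteq> [] \<Longrightarrow> is_period (per w) w"
  unfolding per_def by (rule LeastI[of _ "length w"]) (simp add: is_period_def Suc_le_eq)

lemma per_le: "is_period p w \<Longrightarrow> per w \<le> p"
  unfolding per_def by (rule Least_le)

lemma is_period_map_upt:
  "is_period p (map f [i..<j]) \<longleftrightarrow> 1 \<le> p \<and> p \<le> j - i \<and> periodic_on f p i (j - 1)"
proof -
  have "(\<forall>d < j - i - p. f (i + d) = f (i + (d + p))) \<longleftrightarrow> periodic_on f p i (j - 1)" if "1 \<le> p" "p \<le> j - i"
  proof
    assume *: "\<forall>d < j - i - p. f (i + d) = f (i + (d + p))"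
    show "periodic_on f p i (j - 1)"
      unfolding periodic_on_def
    proof (intro allI impI)
      fix d assume "i \<le> d" "d + p \<le> j - 1"
      then show "f d = f (d + p)" using *[rule_format, of "d - i"] that by simp
    qed
  next
    assume "periodic_on f p i (j - 1)"
    then show "\<forall>d < j - i - p. f (i + d) = f (i + (d + p))"
      using periodic_onD[of f p i "j - 1"] that by (auto simp: add.assoc)
  qed
  then show ?thesis unfolding is_period_def by (auto simp: add.assoc)
qed

text \<open>
  The factor of \<open>s\<close> consists of the blocks that the factor of the image touches. The
  value of \<open>j'\<close> is stated so that this factor stays within a finite word whose image contains
  the given one.
\<close>

lemma factor_exponent_descends:
  assumes sync: "synchronizing k U" and k: "k \<ge> 1" and "i < j"
    and exp: "word_exp (map (letterwise_image k U s) [i..<j]) > 3"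
  shows "\<exists>i' j'. i' < j' \<and> j' = Suc ((j - 1) div k) \<and>
    word_exp (map (letterwise_image k U s) [i..<j]) \<le> word_exp (map s [i'..<j'])"
proof -
  let ?f = "letterwise_image k U s"
  define p where "p = per (map ?f [i..<j])"
  have per: "1 \<le> p" "p \<le> j - i" "periodic_on ?f p i (j - 1)"
    using is_period_per[of "map ?f [i..<j]"] assms(3) by (auto simp: p_def is_period_map_upt)
  have we: "word_exp (map ?f [i..<j]) = real (j - i) / real p" by (simp add: word_exp_def p_def)
  with exp per have "real (3 * p) < real (j - i)" by (simp add: field_simps)
  then have long: "3 * p < j - i" by linarith
  have "i + 3 * p \<le> j - 1" using long by linarith
  with per(3) have "periodic_on ?f p i (i + 3 * p)" by (auto intro: periodic_on_subinterval)
  then have "k dvd p" using sync per(1) unfolding synchronizing_def by blast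
  then obtain q where q: "p = k * q" by blast
  define i' j' where "i' = i div k" and "j' = Suc ((j - 1) div k)"
  have lt: "i' < j'" using assms(3) by (simp add: i'_def j'_def div_le_mono less_Suc_eq_le)
  have sper: "periodic_on s q i' (j' - 1)"
    using period_descends[OF k assms(3), of q U s] per long q by (simp add: i'_def j'_def)
  have "k * i' \<le> i" by (simp add: i'_def)
  have "j \<le> k * j'" using k dividend_less_times_div[of k "j - 1"] assms(3) by (simp add: j'_def)
  then have len: "j - i \<le> k * (j' - i')" using \<open>k * i' \<le> i\<close> by (simp add: diff_mult_distrib2)
  have "k * q \<le> k * (j' - i')" using len per(2) q by linarith
  then have "is_period q (map s [i'..<j'])"
    using sper per(1) q k by (auto simp: is_period_map_upt Suc_le_eq)
  then have le: "per (map s [i'..<j']) \<le> q" by (rule per_le)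
  have pos: "per (map s [i'..<j']) \<ge> 1"
    using is_period_per[of "map s [i'..<j']"] lt by (auto simp: is_period_def)
  have "real (j - i) / real p \<le> real (k * (j' - i')) / real p"
    using len by (intro divide_right_mono) (simp_all only: of_nat_le_iff of_nat_0_le_iff)
  also have "\<dots> = real (j' - i') / real q" using k by (simp add: q)
  also have "\<dots> \<le> real (j' - i') / real (per (map s [i'..<j']))"
    using le pos by (intro divide_left_mono) auto
  also have "\<dots> = word_exp (map s [i'..<j'])" by (simp add: word_exp_def)
  finally show ?thesis using we lt j'_def by auto
qed

definition complementary_morphism :: "nat \<Rightarrow> (nat \<Rightarrow> bool) \<Rightarrow> bool list \<Rightarrow> bool list" where
  "complementary_morphism k U w = concat (map (\<lambda>a. map (\<lambda>i. U i \<noteq> a) [0..<k]) w)"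

lemma uniform_complementary_morphism: "uniform_morphism k (complementary_morphism k U)"
  by (simp add: uniform_morphism_def morphism_def complementary_morphism_def)

lemma complementary_complementary_morphism: "complementary (complementary_morphism k U)"
  unfolding complementary_def
  using uniform_complementary_morphism by (auto simp: complementary_morphism_def complement_def)

lemma complementary_morphism_map_upt:
  assumes "k \<ge> 1"
  shows "complementary_morphism k U (map s [0..<n]) = map (letterwise_image k U s) [0..<k * n]"
proof (induction n)
  case (Suc n)
  have "[0..<k * Suc n] = [0..<k * n] @ map (\<lambda>i. i + k * n) [0..<k]"
    using upt_add_eq_append[of 0 "k * n" k] map_add_upt[of "k * n" k] by (simp add: add.commute)
  moreover have "letterwise_image k U s (i + k * n) = (U i \<noteq> s n)" if "i < k" for i
    using letterwise_image_step[OF that] by (simp add: add.commute)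
  ultimately show ?case using Suc by (simp add: complementary_morphism_def)
qed (simp add: complementary_morphism_def)

lemma is_factor_Fin_map_upt:
  "is_factor x (Fin (map f [0..<N])) \<and> x \<noteq> [] \<longleftrightarrow> (\<exists>i j. i < j \<and> j \<le> N \<and> x = map f [i..<j])"
proof
  assume "is_factor x (Fin (map f [0..<N])) \<and> x \<noteq> []"
  then obtain ys zs where *: "map f [0..<N] = ys @ x @ zs" "x \<noteq> []" by (auto simp: sublist_def)
  define i j where "i = length ys" and "j = length ys + length x"
  have "length (map f [0..<N]) = length (ys @ x @ zs)" using *(1) by simp
  then have "j \<le> N" by (simp add: j_def)
  have "x = take (length x) (drop i (map f [0..<N]))" by (simp add: * i_def)
  also have "\<dots> = map f [i..<j]" using \<open>j \<le> N\<close> by (simp add: take_map drop_map i_def j_def)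
  finally show "\<exists>i j. i < j \<and> j \<le> N \<and> x = map f [i..<j]"
    using \<open>j \<le> N\<close> *(2) by (intro exI[of _ i] exI[of _ j]) (auto simp: i_def j_def)
next
  assume "\<exists>i j. i < j \<and> j \<le> N \<and> x = map f [i..<j]"
  then obtain i j where *: "i < j" "j \<le> N" "x = map f [i..<j]" by blast
  have "[0..<N] = [0..<i] @ [i..<j] @ [j..<N]"
    using * by (metis le_add_diff_inverse less_imp_le upt_add_eq_append zero_le le_trans)
  then show "is_factor x (Fin (map f [0..<N])) \<and> x \<noteq> []" using * by (auto simp: sublist_def)
qed

lemma is_factor_Inf: "is_factor x (Inf f) \<and> x \<noteq> [] \<longleftrightarrow> (\<exists>i j. i < j \<and> x = map f [i..<j])"
proof
  assume x: "is_factor x (Inf f) \<and> x \<noteq> []"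
  then obtain i j where "x = map f [i..<j]" by auto
  moreover from this x have "i < j" by (cases "i < j") auto
  ultimately show "\<exists>i j. i < j \<and> x = map f [i..<j]" by blast
qed auto

lemma cexp_le_max:
  assumes "\<And>x. is_factor x v \<Longrightarrow> x \<noteq> [] \<Longrightarrow> word_exp x > 3 \<Longrightarrow>
    \<exists>y. is_factor y w \<and> y \<noteq> [] \<and> word_exp x \<le> word_exp y"
  shows "cexp v \<le> max 3 (cexp w)"
  unfolding cexp_def[of v]
proof (rule SUP_least)
  fix x assume x: "x \<in> {x. is_factor x v \<and> x \<noteq> []}"
  show "ereal (word_exp x) \<le> max 3 (cexp w)"
  proof (cases "word_exp x > 3")
    case True
    then obtain y where y: "is_factor y w" "y \<noteq> []" "word_exp x \<le> word_exp y" using assms x by blast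
    then have "ereal (word_exp y) \<le> cexp w" unfolding cexp_def by (intro SUP_upper) simp
    with y(3) show ?thesis by (simp add: le_max_iff_disj) (meson ereal_less_eq(3) order_trans)
  next
    case False
    then have "ereal (word_exp x) \<le> ereal 3" by simp
    then show ?thesis by (simp add: le_max_iff_disj)
  qed
qed

text \<open>
  A finite word is treated as a prefix of a sequence, so that finite and infinite words share the
  argument on sequences.
\<close>

lemma cexp_complementary_morphism_le:
  assumes sync: "synchronizing k U" and k: "k \<ge> 1"
  shows "cexp (morph_image (complementary_morphism k U) w) \<le> max 3 (cexp w)"
proof (rule cexp_le_max)
  fix x assume x: "is_factor x (morph_image (complementary_morphism k U) w)" "x \<noteq> []"
    and exp: "word_exp x > 3"
  show "\<exists>y. is_factor y w \<and> y \<noteq> [] \<and> word_exp x \<le> word_exp y"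
  proof (cases w)
    case (Fin u)
    define s N where "s = (!) u" and "N = length u"
    have u: "u = map s [0..<N]" by (simp add: s_def N_def map_nth)
    have "is_factor x (Fin (map (letterwise_image k U s) [0..<k * N])) \<and> x \<noteq> []"
      using x Fin complementary_morphism_map_upt[OF k, of U s N] u by simp
    then obtain i j where ij: "i < j" "j \<le> k * N" "x = map (letterwise_image k U s) [i..<j]"
      unfolding is_factor_Fin_map_upt by blast
    obtain i' j' where *: "i' < j'" "j' = Suc ((j - 1) div k)" "word_exp x \<le> word_exp (map s [i'..<j'])"
      using factor_exponent_descends[OF sync k ij(1), of s] exp ij(3) by blast
    have "(j - 1) div k < N" using ij k by (intro less_mult_imp_div_less) (simp add: mult.commute)
    then have "j' \<le> N" using *(2) by simp
    then show ?thesis using * is_factor_Fin_map_upt[of _ s N] u Fin by blast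
  next
    case (Inf s)
    have "(\<lambda>i. complementary_morphism k U [s (i div k)] ! (i mod k)) = letterwise_image k U s"
      using k by (auto simp: complementary_morphism_def letterwise_image_def)
    then have "is_factor x (Inf (letterwise_image k U s)) \<and> x \<noteq> []"
      using x morph_image_uniform[OF uniform_complementary_morphism k, of U s] Inf by simp
    then obtain i j where ij: "i < j" "x = map (letterwise_image k U s) [i..<j]"
      unfolding is_factor_Inf by blast
    then show ?thesis
      using factor_exponent_descends[OF sync k ij(1), of s] exp is_factor_Inf[of _ s] Inf by blast
  qed
qed

lemma free_word_if_cexp_le_max:
  assumes "\<alpha> \<ge> Pl 3" and "cexp v \<le> max 3 (cexp w)" and "free_word \<alpha> w"
  shows "free_word \<alpha> v"
proof (cases \<alpha>)
  case (Rl a)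
  then have "3 < ereal a" using assms(1) by (simp add: less_eq_hreal_def)
  then show ?thesis using assms Rl by (auto intro: le_less_trans)
next
  case (Pl a)
  then have "3 \<le> ereal a" using assms(1) by (auto simp: less_eq_hreal_def)
  then show ?thesis using assms Pl by (auto intro: order_trans)
qed

theorem theorem7:
  fixes \<alpha> :: hreal and k :: nat
  assumes "\<alpha> \<ge> Pl 3" and "k \<ge> 1"
  shows "\<exists>h :: bool list \<Rightarrow> bool list.
           uniform_morphism k h \<and> complementary h \<and> free_morphism \<alpha> h"
proof -
  obtain U where sync: "synchronizing k U" using synchronizing_exists[OF assms(2)] by blast
  have "free_morphism \<alpha> (complementary_morphism k U)"
    using uniform_complementary_morphism[of k U]
      free_word_if_cexp_le_max[OF assms(1) cexp_complementary_morphism_le[OF sync assms(2)]]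
    by (auto simp: free_morphism_def uniform_morphism_def)
  then show ?thesis
    using uniform_complementary_morphism complementary_complementary_morphism by blast
qed

end
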